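(* Let $q\ge 1$ and $p=1-q$. Let $\{X_t\}_{t\in\mathbb{N}}$ be the Markov chain in which, given $X_{t-1}=x\in(0,1)$, the next state $X_t$ is uniform on $(0,x)$ with probability $\frac{x^p}{x^p+(1-x)^p}$ and uniform on $(x,1)$ with probability $\frac{(1-x)^p}{x^p+(1-x)^p}$. Then $\{X_t\}_{t\in\mathbb{N}}$ is an $\ell_q$-minimizing martingale, that is, for every $t$, $$\operatorname{middle}_q(X_t\mid X_{t-1},\ldots,X_1)=X_{t-1}.$$
   Context: For $q>0$ and a random variable $X$, $\operatorname{middle}_q(X)=\arg\min_{z}\mathbb{E}|z-X|^q$ with $z$ ranging over $\mathbb{R}$, so $\operatorname{middle}_q(X)=m$ means that $m$ is a minimizer of $z\mapsto\mathbb{E}|z-X|^q$. The conditional version $\operatorname{middle}_q(X_t\mid X_{t-1},\ldots,X_1)$ is the same quantity computed for the conditional law of $X_t$ given $X_{t-1},\ldots,X_1$. For $q=1$, $\operatorname{middle}_1$ is the median. The chain takes values in $(0,1)$; when $p<0$ its definition is extended by declaring $0$ and $1$ to be absorbing states. *)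

theory Defs
  imports "HOL-Probability.Probability"
begin

text \<open>The state space: \<open>(0,1)\<close>, enlarged by the absorbing states \<open>0\<close> and \<open>1\<close> when \<open>p < 0\<close>.\<close>

definition chain_states :: "real \<Rightarrow> real set" where
  "chain_states p = (if p < 0 then {0..1} else {0<..<1})"

text \<open>
  The law of the next state given that the current state is \<open>x\<close>: a coin with success probability
  \<open>x\<^sup>p / (x\<^sup>p + (1 - x)\<^sup>p)\<close> decides between the uniform laws on \<open>(0,x)\<close> and on \<open>(x,1)\<close>.
  The Dirac law outside \<open>(0,1)\<close> makes \<open>0\<close> and \<open>1\<close> absorbing; all other points outside \<open>(0,1)\<close>,
  and for \<open>p \<ge> 0\<close> also \<open>0\<close> and \<open>1\<close>, are not states, so the value there is immaterial.
\<close>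

definition chain_kernel :: "real \<Rightarrow> real \<Rightarrow> real measure" where
  "chain_kernel p x =
    (if 0 < x \<and> x < 1 then
       measure_pmf (bernoulli_pmf (x powr p / (x powr p + (1 - x) powr p))) \<bind>
         (\<lambda>left. if left then uniform_measure lborel {0<..<x} else uniform_measure lborel {x<..<1})
     else return borel x)"

text \<open>The sigma-algebra generated by \<open>X 1, \<dots>, X t\<close>; processes are indexed by \<open>t \<ge> 1\<close>, and
  \<open>X 0\<close> plays no role.\<close>

definition history :: "'a measure \<Rightarrow> (nat \<Rightarrow> 'a \<Rightarrow> real) \<Rightarrow> nat \<Rightarrow> 'a measure" where
  "history M X t =
    vimage_algebra (space M) (\<lambda>\<omega>. \<lambda>i\<in>{1..t}. X i \<omega>) (\<Pi>\<^sub>M i\<in>{1..t}. borel)"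

text \<open>\<open>\<kappa>\<close> is a regular conditional distribution of \<open>Y\<close> given the sub-sigma-algebra \<open>F\<close>.\<close>

definition is_cond_law ::
  "'a measure \<Rightarrow> 'a measure \<Rightarrow> ('a \<Rightarrow> real) \<Rightarrow> ('a \<Rightarrow> real measure) \<Rightarrow> bool" where
  "is_cond_law M F Y \<kappa> \<longleftrightarrow>
    \<kappa> \<in> F \<rightarrow>\<^sub>M prob_algebra borel \<and>
    (\<forall>B\<in>sets borel. AE \<omega> in M.
       measure (\<kappa> \<omega>) B = real_cond_exp M F (\<lambda>\<omega>'. indicator B (Y \<omega>')) \<omega>)"

text \<open>The initial law, that of \<open>X 1\<close>, is an arbitrary law on the state space.\<close>

definition is_middle_chain :: "'a measure \<Rightarrow> real \<Rightarrow> (nat \<Rightarrow> 'a \<Rightarrow> real) \<Rightarrow> bool" where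
  "is_middle_chain M p X \<longleftrightarrow>
    prob_space M \<and>
    (\<forall>t\<ge>1. X t \<in> borel_measurable M \<and> (AE \<omega> in M. X t \<omega> \<in> chain_states p)) \<and>
    (\<forall>t\<ge>1. is_cond_law M (history M X t) (X (Suc t)) (\<lambda>\<omega>. chain_kernel p (X t \<omega>)))"

text \<open>The number \<open>m\<close> is a \<open>q\<close>-middle of the law \<open>\<mu>\<close>. Minimizers need not be unique
  (medians, \<open>q = 1\<close>), hence a predicate.\<close>

definition is_middle :: "real \<Rightarrow> real measure \<Rightarrow> real \<Rightarrow> bool" where
  "is_middle q \<mu> m \<longleftrightarrow>
    is_arg_min (\<lambda>z. \<integral>\<^sup>+ x. ennreal (\<bar>z - x\<bar> powr q) \<partial>\<mu>) (\<lambda>_. True) m"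

text \<open>Conditional laws are only determined almost surely, so the middle condition is required
  of every version, and a version is required to exist.\<close>

definition lq_minimizing_martingale :: "real \<Rightarrow> 'a measure \<Rightarrow> (nat \<Rightarrow> 'a \<Rightarrow> real) \<Rightarrow> bool" where
  "lq_minimizing_martingale q M X \<longleftrightarrow>
    (\<forall>t\<ge>1.
       (\<exists>\<kappa>. is_cond_law M (history M X t) (X (Suc t)) \<kappa>) \<and>
       (\<forall>\<kappa>. is_cond_law M (history M X t) (X (Suc t)) \<kappa> \<longrightarrow>
          (AE \<omega> in M. is_middle q (\<kappa> \<omega>) (X t \<omega>))))"

end

theory Submission
  imports Defs
begin

text \<open>
  By convexity of \<open>\<bar>\<cdot>\<bar> powr q\<close>, the function \<open>z \<mapsto> E \<bar>z - X\<bar>\<^sup>q\<close> lies above its tangent at \<open>z = x\<close>.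
  For \<open>p = 1 - q\<close> the uniform pieces of the kernel at \<open>x\<close> have densities proportional to
  \<open>x\<^sup>-\<^sup>q\<close> and \<open>(1 - x)\<^sup>-\<^sup>q\<close>, which exactly cancel \<open>q \<integral>\<^sub>0\<^sup>x (x - y)\<^sup>q\<^sup>-\<^sup>1 dy = x\<^sup>q\<close> and its mirror image, so
  this tangent is horizontal. Conditional laws being almost surely unique, the statement for
  the kernel transfers to every version.
\<close>

section \<open>Tangent-line inequalities for powers\<close>

lemma powr_tangent_le:
  fixes a b q :: real
  assumes "0 < a" "0 \<le> b" "1 \<le> q"
  shows "a powr q + q * a powr (q - 1) * (b - a) \<le> b powr q"
proof (cases "b = 0")
  case True
  have "a powr (q - 1) * a = a powr q"
    using assms by (simp add: powr_diff)
  then have "a powr q + q * a powr (q - 1) * (b - a) = (1 - q) * a powr q"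
    by (simp add: True algebra_simps)
  also have "\<dots> \<le> 0"
    using assms by (simp add: mult_nonpos_nonneg)
  finally show ?thesis
    by (simp add: True)
next
  case False
  \<comment> \<open>The tangent inequality is Young's inequality in disguise: weighted AM-GM for
    \<open>b powr q\<close> and \<open>a powr q\<close> with weights 1/q and 1 - 1/q, multiplied by
    q and rearranged.\<close>
  have "(b powr q) powr (1/q) * (a powr q) powr (1 - 1/q) \<le> (1/q) * b powr q + (1 - 1/q) * a powr q"
    using assms False by (intro Youngs_inequality_0) auto
  moreover have "(b powr q) powr (1/q) = b" "(a powr q) powr (1 - 1/q) = a powr (q - 1)"
    using assms by (auto simp: powr_powr right_diff_distrib)
  ultimately have "q * (b * a powr (q - 1)) \<le> q * ((1/q) * b powr q + (1 - 1/q) * a powr q)"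
    using assms by simp
  also have "\<dots> = b powr q + (q - 1) * a powr q"
    using assms by (simp add: field_simps)
  finally have "q * (b * a powr (q - 1)) \<le> b powr q + (q - 1) * a powr q" .
  moreover have "a powr (q - 1) * a = a powr q"
    using assms by (simp add: powr_diff)
  then have "a powr q + q * a powr (q - 1) * (b - a) = q * (b * a powr (q - 1)) - (q - 1) * a powr q"
    by (simp add: algebra_simps)
  ultimately show ?thesis
    by linarith
qed

text \<open>This reduces to \<open>powr_tangent_le\<close> at \<open>\<bar>v\<bar>\<close> and
  \<open>\<bar>u\<bar>\<close>: the slope is nonnegative there, and
  \<open>sgn v * (u - v) \<le> \<bar>u\<bar> - \<bar>v\<bar>\<close>. At v = 0 the left side
  vanishes, because \<open>sgn 0 = 0\<close> and \<open>0 powr q = 0\<close>; for q = 1 this picks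
  the subgradient 0 at the kink.\<close>

lemma abs_powr_tangent_le:
  fixes u v q :: real
  assumes "1 \<le> q"
  shows "\<bar>v\<bar> powr q + q * sgn v * \<bar>v\<bar> powr (q - 1) * (u - v) \<le> \<bar>u\<bar> powr q"
proof (cases "v = 0")
  case False
  have "sgn v * (u - v) \<le> \<bar>u\<bar> - \<bar>v\<bar>"
    by (auto simp: sgn_if)
  then have "(q * \<bar>v\<bar> powr (q - 1)) * (sgn v * (u - v)) \<le> (q * \<bar>v\<bar> powr (q - 1)) * (\<bar>u\<bar> - \<bar>v\<bar>)"
    using assms by (intro mult_left_mono) auto
  moreover have "\<bar>v\<bar> powr q + q * \<bar>v\<bar> powr (q - 1) * (\<bar>u\<bar> - \<bar>v\<bar>) \<le> \<bar>u\<bar> powr q"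
    using False assms by (intro powr_tangent_le) auto
  ultimately show ?thesis
    by (simp only: mult_ac)
qed simp

section \<open>Integrating the tangent inequality on either side of x\<close>

lemma has_integral_powr_left:
  fixes a x q :: real
  assumes "a \<le> x" "1 \<le> q"
  shows "((\<lambda>y. q * (x - y) powr (q - 1)) has_integral (x - a) powr q) {a..x}"
proof -
  have "((\<lambda>y. q * (x - y) powr (q - 1)) has_integral (- ((x - x) powr q) - - ((x - a) powr q))) {a..x}"
  \<comment> \<open>Derivatives are taken only in the open interval. At the endpoint y = x the base
    is 0, and for q = 1 the integrand there is \<open>0 powr 0 = 0\<close>, not the one-sided
    derivative 1.\<close>
  proof (rule fundamental_theorem_of_calculus_interior)
    show "continuous_on {a..x} (\<lambda>y. - ((x - y) powr q))"
      using assms by (intro continuous_intros continuous_on_powr') auto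
    show "((\<lambda>y. - ((x - y) powr q)) has_vector_derivative q * (x - y) powr (q - 1)) (at y)"
      if "y \<in> {a<..<x}" for y
      unfolding has_real_derivative_iff_has_vector_derivative[symmetric]
      using that by (auto intro!: derivative_eq_intros)
  qed fact
  then show ?thesis
    using assms by simp
qed

lemma has_integral_powr_right:
  fixes b x q :: real
  assumes "x \<le> b" "1 \<le> q"
  shows "((\<lambda>y. q * (y - x) powr (q - 1)) has_integral (b - x) powr q) {x..b}"
proof -
  have "((\<lambda>y. q * (y - x) powr (q - 1)) has_integral ((b - x) powr q - (x - x) powr q)) {x..b}"
  proof (rule fundamental_theorem_of_calculus_interior)
    show "continuous_on {x..b} (\<lambda>y. (y - x) powr q)"
      using assms by (intro continuous_intros continuous_on_powr') auto
    show "((\<lambda>y. (y - x) powr q) has_vector_derivative q * (y - x) powr (q - 1)) (at y)"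
      if "y \<in> {x<..<b}" for y
      unfolding has_real_derivative_iff_has_vector_derivative[symmetric]
      using that by (auto intro!: derivative_eq_intros)
  qed fact
  then show ?thesis
    using assms by simp
qed

lemma continuous_on_abs_diff_powr:
  fixes z q :: real
  assumes "0 < q"
  shows "continuous_on A (\<lambda>y. \<bar>z - y\<bar> powr q)"
  using assms by (intro continuous_on_powr' continuous_intros) auto

text \<open>For y < x the tangent of \<open>\<bar>z - y\<bar> powr q\<close> at z = x has slope
  \<open>q * (x - y) powr (q - 1)\<close>. Integrated over y, these slopes give
  \<open>(x - a) powr q\<close>. To the right of x, \<open>sgn (x - y)\<close> is -1, whence the
  minus sign in the mirror lemma.\<close>

lemma integral_powr_tangent_left:
  fixes a x z q :: real
  assumes "a \<le> x" "1 \<le> q"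
  shows "integral {a..x} (\<lambda>y. \<bar>x - y\<bar> powr q) + (z - x) * (x - a) powr q
    \<le> integral {a..x} (\<lambda>y. \<bar>z - y\<bar> powr q)"
proof -
  have int: "(\<lambda>y. \<bar>w - y\<bar> powr q) integrable_on {a..x}" for w
    using assms by (intro integrable_continuous_interval continuous_on_abs_diff_powr) auto
  show ?thesis
  proof (rule has_integral_le)
    show "((\<lambda>y. \<bar>x - y\<bar> powr q + (z - x) * (q * (x - y) powr (q - 1))) has_integral
        (integral {a..x} (\<lambda>y. \<bar>x - y\<bar> powr q) + (z - x) * (x - a) powr q)) {a..x}"
      using assms int by (intro has_integral_add has_integral_mult_right has_integral_powr_left)
        (auto intro: integrable_integral)
    show "((\<lambda>y. \<bar>z - y\<bar> powr q) has_integral integral {a..x} (\<lambda>y. \<bar>z - y\<bar> powr q)) {a..x}"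
      using int by (rule integrable_integral)
    show "\<bar>x - y\<bar> powr q + (z - x) * (q * (x - y) powr (q - 1)) \<le> \<bar>z - y\<bar> powr q"
      if "y \<in> {a..x}" for y
      using abs_powr_tangent_le[OF \<open>1 \<le> q\<close>, of "x - y" "z - y"] that
      by (cases "x = y") (auto simp: mult_ac)
  qed
qed

lemma integral_powr_tangent_right:
  fixes b x z q :: real
  assumes "x \<le> b" "1 \<le> q"
  shows "integral {x..b} (\<lambda>y. \<bar>x - y\<bar> powr q) - (z - x) * (b - x) powr q
    \<le> integral {x..b} (\<lambda>y. \<bar>z - y\<bar> powr q)"
proof -
  have int: "(\<lambda>y. \<bar>w - y\<bar> powr q) integrable_on {x..b}" for w
    using assms by (intro integrable_continuous_interval continuous_on_abs_diff_powr) auto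
  show ?thesis
  proof (rule has_integral_le)
    show "((\<lambda>y. \<bar>x - y\<bar> powr q - (z - x) * (q * (y - x) powr (q - 1))) has_integral
        (integral {x..b} (\<lambda>y. \<bar>x - y\<bar> powr q) - (z - x) * (b - x) powr q)) {x..b}"
      using assms int by (intro has_integral_diff has_integral_mult_right has_integral_powr_right)
        (auto intro: integrable_integral)
    show "((\<lambda>y. \<bar>z - y\<bar> powr q) has_integral integral {x..b} (\<lambda>y. \<bar>z - y\<bar> powr q)) {x..b}"
      using int by (rule integrable_integral)
    show "\<bar>x - y\<bar> powr q - (z - x) * (q * (y - x) powr (q - 1)) \<le> \<bar>z - y\<bar> powr q"
      if "y \<in> {x..b}" for y
      using abs_powr_tangent_le[OF \<open>1 \<le> q\<close>, of "x - y" "z - y"] that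
      by (cases "x = y") (auto simp: mult_ac)
  qed
qed

section \<open>Expectations under the kernel and its middle\<close>

lemma nn_integral_uniform_measure_Ioo:
  fixes f :: "real \<Rightarrow> real"
  assumes "a < b" "continuous_on UNIV f" "\<And>y. 0 \<le> f y"
  shows "(\<integral>\<^sup>+y. f y \<partial>uniform_measure lborel {a<..<b}) = ennreal (integral {a..b} f / (b - a))"
proof -
  have [measurable]: "f \<in> borel_measurable borel"
    using assms(2) by (rule borel_measurable_continuous_onI)
  have "f integrable_on {a..b}"
    using assms(2) by (intro integrable_continuous_interval) (auto intro: continuous_on_subset)
  then have int: "(f has_integral integral {a..b} f) {a<..<b}"
    by (simp add: integrable_integral flip: has_integral_Icc_iff_Ioo)
  have "(\<integral>\<^sup>+y. f y \<partial>uniform_measure lborel {a<..<b})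
    = (\<integral>\<^sup>+y. ennreal (f y) * indicator {a<..<b} y \<partial>lborel) / emeasure lborel {a<..<b}"
    by (rule nn_integral_uniform_measure) auto
  also have "\<dots> = ennreal (integral {a..b} f) / ennreal (b - a)"
    using nn_integral_has_integral_lebesgue'[OF assms(3) int] assms(1) by simp
  also have "\<dots> = ennreal (integral {a..b} f / (b - a))"
    using assms \<open>f integrable_on {a..b}\<close> by (intro divide_ennreal integral_nonneg) auto
  finally show ?thesis .
qed

text \<open>Each branch has weight \<open>x powr p\<close> or \<open>(1 - x) powr p\<close> over the
  common normalizer; dividing by the interval length x or 1 - x lowers the exponent to p - 1, which
  is -q when p = 1 - q. The normalizer is positive and independent of f, so it drops out when two
  expectations are compared.\<close>

lemma nn_integral_chain_kernel:
  fixes f :: "real \<Rightarrow> real"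
  assumes x: "0 < x" "x < 1" and f: "continuous_on UNIV f" "\<And>y. 0 \<le> f y"
  shows "(\<integral>\<^sup>+y. f y \<partial>chain_kernel p x) = ennreal
    ((x powr (p - 1) * integral {0..x} f + (1 - x) powr (p - 1) * integral {x..1} f)
      / (x powr p + (1 - x) powr p))"
proof -
  define S where "S = x powr p + (1 - x) powr p"
  define w where "w = x powr p / S"
  let ?U = "\<lambda>left. if left then uniform_measure lborel {0<..<x} else uniform_measure lborel {x<..<1}"
  have pos: "0 < x powr p" "0 < (1 - x) powr p"
    using x by auto
  then have "S > 0"
    unfolding S_def by (rule add_pos_pos)
  then have w: "0 \<le> w" "w \<le> 1" and w': "1 - w = (1 - x) powr p / S"
    using pos by (simp_all add: w_def diff_divide_eq_iff) (simp_all add: S_def)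
  have [measurable]: "f \<in> borel_measurable borel"
    using f(1) by (rule borel_measurable_continuous_onI)
  \<comment> \<open>Every set of booleans is measurable for the pmf, so it only remains that both
    branches are probability measures: both intervals have positive finite length.\<close>
  have U: "?U \<in> measure_pmf (bernoulli_pmf w) \<rightarrow>\<^sub>M subprob_algebra borel"
    using x by (auto simp: space_subprob_algebra
        intro!: prob_space_imp_subprob_space prob_space_uniform_measure split: if_splits)
  have nonneg: "0 \<le> integral {a..b} f" for a b
    using f by (intro integral_nonneg integrable_continuous_interval)
      (auto intro: continuous_on_subset)
  have "(\<integral>\<^sup>+y. f y \<partial>chain_kernel p x)
    = (\<integral>\<^sup>+left. \<integral>\<^sup>+y. f y \<partial>?U left \<partial>measure_pmf (bernoulli_pmf w))"
    using x by (simp add: chain_kernel_def w_def S_def nn_integral_bind[OF _ U[unfolded w_def S_def]])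
  also have "\<dots> = ennreal (integral {0..x} f / x) * ennreal w
      + ennreal (integral {x..1} f / (1 - x)) * ennreal (1 - w)"
    using x f w by (simp add: nn_integral_uniform_measure_Ioo)
  also have "\<dots> = ennreal (integral {0..x} f / x * w + integral {x..1} f / (1 - x) * (1 - w))"
    using w x nonneg by (simp add: ennreal_mult ennreal_plus del: times_divide_eq_left)
  also have "integral {0..x} f / x * w + integral {x..1} f / (1 - x) * (1 - w)
    = (x powr (p - 1) * integral {0..x} f + (1 - x) powr (p - 1) * integral {x..1} f) / S"
    unfolding w' using x \<open>S > 0\<close> by (simp add: w_def powr_diff field_simps)
  finally show ?thesis
    by (simp add: S_def)
qed

lemma is_middleI:
  assumes "\<And>z. (\<integral>\<^sup>+y. ennreal (\<bar>m - y\<bar> powr q) \<partial>\<mu>) \<le> (\<integral>\<^sup>+y. ennreal (\<bar>z - y\<bar> powr q) \<partial>\<mu>)"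
  shows "is_middle q \<mu> m"
  using assms by (auto simp: is_middle_def is_arg_min_def not_less)

lemma is_middle_chain_kernel:
  assumes "1 \<le> q"
  shows "is_middle q (chain_kernel (1 - q) x) x"
proof (cases "0 < x \<and> x < 1")
  case True
  let ?I = "\<lambda>A z. integral A (\<lambda>y. \<bar>z - y\<bar> powr q)"
  have "x powr - q * ?I {0..x} x + (1 - x) powr - q * ?I {x..1} x
    \<le> x powr - q * ?I {0..x} z + (1 - x) powr - q * ?I {x..1} z" for z
  proof -
    have "x powr - q * (?I {0..x} x + (z - x) * x powr q) \<le> x powr - q * ?I {0..x} z"
      using integral_powr_tangent_left[of 0 x q z] True assms by (intro mult_left_mono) auto
    moreover have "(1 - x) powr - q * (?I {x..1} x - (z - x) * (1 - x) powr q)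
        \<le> (1 - x) powr - q * ?I {x..1} z"
      using integral_powr_tangent_right[of x 1 q z] True assms by (intro mult_left_mono) auto
    \<comment> \<open>The weights turn the two slopes into 1 and -1, so z - x cancels when the two
      inequalities are added.\<close>
    moreover have "x powr - q * x powr q = 1" "(1 - x) powr - q * (1 - x) powr q = 1"
      using True by (auto simp flip: powr_add)
    then have "x powr - q * (?I {0..x} x + (z - x) * x powr q) = x powr - q * ?I {0..x} x + (z - x)"
      "(1 - x) powr - q * (?I {x..1} x - (z - x) * (1 - x) powr q)
        = (1 - x) powr - q * ?I {x..1} x - (z - x)"
      by (simp_all add: distrib_left right_diff_distrib mult.left_commute)
    ultimately show ?thesis
      by linarith
  qed
  then show ?thesis
    using True assms
    by (intro is_middleI)
      (simp add: nn_integral_chain_kernel continuous_on_abs_diff_powr ennreal_leI divide_right_mono)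
next
  case False
  then show ?thesis
    \<comment> \<open>Under the Dirac law at x the cost of z is
      \<open>\<bar>z - x\<bar> powr q\<close>, which attains its least value 0 at z = x.\<close>
    by (intro is_middleI) (auto simp: chain_kernel_def nn_integral_return)
qed

section \<open>Almost sure uniqueness of conditional laws\<close>

text \<open>For y > x choose a rational r strictly between them; then
  \<open>F x \<le> F r = G r \<le> G y\<close>, and y tends to x from the right. Used with both
  orders of two distribution functions, this yields their equality.\<close>

lemma le_of_eq_on_rats:
  fixes F G :: "real \<Rightarrow> real"
  assumes "\<And>x y. x \<le> y \<Longrightarrow> F x \<le> F y" "\<And>x y. x \<le> y \<Longrightarrow> G x \<le> G y"
    and cont: "continuous (at_right x) G" and eq: "\<And>r. F (of_rat r) = G (of_rat r)"
  shows "F x \<le> G x"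
proof (rule tendsto_lowerbound)
  show "(G \<longlongrightarrow> G x) (at_right x)"
    using cont by (simp add: continuous_within)
  show "\<forall>\<^sub>F y in at_right x. F x \<le> G y"
  proof (rule eventually_at_rightI[of x "x + 1"])
    fix y assume "y \<in> {x<..<x + 1}"
    then obtain r where "x < of_rat r" "of_rat r < y"
      using of_rat_dense[of x y] by auto
    then show "F x \<le> G y"
      using assms(1)[of x "of_rat r"] assms(2)[of "of_rat r" y] eq[of r] by simp
  qed simp
qed simp

text \<open>The exceptional null set in \<open>is_cond_law\<close> depends on the Borel set B.
  Half-lines with rational endpoints are countably many, so one null set serves them all, and off it
  they determine the whole distribution function and hence the law.\<close>

lemma is_cond_law_unique:
  assumes F: "space F = space M"
    and \<kappa>: "is_cond_law M F Y \<kappa>" and \<kappa>': "is_cond_law M F Y \<kappa>'"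
  shows "AE \<omega> in M. \<kappa> \<omega> = \<kappa>' \<omega>"
proof -
  have "AE \<omega> in M. measure (\<kappa> \<omega>) {..of_rat r} = measure (\<kappa>' \<omega>) {..of_rat r :: real}" for r
  proof -
    have "AE \<omega> in M. measure (\<kappa> \<omega>) {..of_rat r}
        = real_cond_exp M F (\<lambda>\<omega>'. indicator {..of_rat r} (Y \<omega>')) \<omega>"
      "AE \<omega> in M. measure (\<kappa>' \<omega>) {..of_rat r}
        = real_cond_exp M F (\<lambda>\<omega>'. indicator {..of_rat r} (Y \<omega>')) \<omega>"
      using \<kappa> \<kappa>' unfolding is_cond_law_def by auto
    then show ?thesis
      by eventually_elim simp
  qed
  then have "AE \<omega> in M. \<forall>r. measure (\<kappa> \<omega>) {..of_rat r} = measure (\<kappa>' \<omega>) {..of_rat r :: real}"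
    by (simp add: AE_all_countable)
  then show ?thesis
  proof (rule AE_mp, intro AE_I2 impI)
    fix \<omega>
    assume \<omega>: "\<omega> \<in> space M"
      and eq: "\<forall>r. measure (\<kappa> \<omega>) {..of_rat r} = measure (\<kappa>' \<omega>) {..of_rat r :: real}"
    \<comment> \<open>Measurability into \<open>prob_algebra borel\<close> is relative to F;
      \<open>space F = space M\<close> makes it yield a probability law at every point of
      \<open>space M\<close>.\<close>
    have "real_distribution (\<kappa> \<omega>)" "real_distribution (\<kappa>' \<omega>)"
      using \<kappa> \<kappa>' \<omega> F measurable_space[of _ F "prob_algebra borel" \<omega>]
      by (auto simp: is_cond_law_def space_prob_algebra real_distribution_def
          real_distribution_axioms_def sets_eq_imp_space_eq[of _ borel])
    then interpret K: real_distribution "\<kappa> \<omega>" + K': real_distribution "\<kappa>' \<omega>"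
      by auto
    have "cdf (\<kappa> \<omega>) x = cdf (\<kappa>' \<omega>) x" for x
      using le_of_eq_on_rats[of "cdf (\<kappa> \<omega>)" "cdf (\<kappa>' \<omega>)", OF K.cdf_nondecreasing K'.cdf_nondecreasing K'.cdf_is_right_cont]
        le_of_eq_on_rats[of "cdf (\<kappa>' \<omega>)" "cdf (\<kappa> \<omega>)", OF K'.cdf_nondecreasing K.cdf_nondecreasing K.cdf_is_right_cont] eq
      by (simp add: cdf_def antisym)
    then show "\<kappa> \<omega> = \<kappa>' \<omega>"
      by (intro cdf_unique K.real_distribution_axioms K'.real_distribution_axioms) auto
  qed
qed

theorem proposition3p1:
  fixes q p :: real and M :: "'a measure" and X :: "nat \<Rightarrow> 'a \<Rightarrow> real"
  assumes "q \<ge> 1" and "p = 1 - q"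
    and "is_middle_chain M p X"
  shows "lq_minimizing_martingale q M X"
  unfolding lq_minimizing_martingale_def
proof (intro allI impI conjI)
  fix t :: nat
  assume "1 \<le> t"
  then have law: "is_cond_law M (history M X t) (X (Suc t)) (\<lambda>\<omega>. chain_kernel p (X t \<omega>))"
    using assms(3) by (simp add: is_middle_chain_def)
  then show "\<exists>\<kappa>. is_cond_law M (history M X t) (X (Suc t)) \<kappa>"
    by blast
  fix \<kappa>
  assume "is_cond_law M (history M X t) (X (Suc t)) \<kappa>"
  \<comment> \<open>Any version agrees almost surely with the kernel at \<open>X t\<close>, for
    which the minimizer has already been found pointwise.\<close>
  then have "AE \<omega> in M. \<kappa> \<omega> = chain_kernel p (X t \<omega>)"
    using law by (rule is_cond_law_unique[rotated]) (simp add: history_def)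
  then show "AE \<omega> in M. is_middle q (\<kappa> \<omega>) (X t \<omega>)"
    by eventually_elim (simp add: assms(2) is_middle_chain_kernel[OF assms(1)])
qed

end
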